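(* (a) Assume Conjecture A (stated in the context). Then for every integer $n\ge 1$, the sequence of iterates $(S_{2,3}^k(n))_{k\ge0}$ eventually reaches a cycle or a fixed point of $S_{2,3}$. (b) Assume Conjecture B (stated in the context). Then for every integer $b\ge 4$ and every integer $n\ge1$, the sequence of iterates $(S_{2,b}^k(n))_{k\ge0}$ eventually reaches a cycle or a fixed point of $S_{2,b}$.
   Context: For integers $t\ge 0$, $b\ge 2$, the $t$-shifted Sloane map in base $b$ is $S_{t,b}(n)=\prod_{i=0}^k (d_i+t)$, where $n=\sum_{i=0}^k d_ib^i$ is the base-$b$ expansion of $n$ ($0\le d_i\le b-1$, $d_k>0$); $S_{t,b}^k$ is its $k$-th iterate. For a base $q$, a digit $d$ and a positive integer $n$, $\#d(n)_q$ is the number of occurrences of $d$ in the base-$q$ expansion of $n$ and $\#(n)_q$ the number of base-$q$ digits of $n$. Given $\varepsilon>0$, $n$ is $\varepsilon$-equidistributed in base $q$ if $\left|\frac{\#d(n)_q}{\#(n)_q}-\frac1q\right|<\varepsilon$ for every $d\in\{0,\dots,q-1\}$. Conjecture A: For every integer $q>1$, every finite set $F$ of primes that does not contain all primes dividing $q$, and every positive integer $a$, if $N_0=a$ and $N_{k+1}=N_kp_k$ with $p_k\in F$ for all $k\ge0$, then for every $\varepsilon>0$ there is $n_0$ such that $N_n$ is $\varepsilon$-equidistributed in base $q$ for all $n\ge n_0$. Conjecture B: For every integer $q>1$, every finite set $F=\{p_1,\dots,p_k\}$ of primes that does not contain all primes dividing $q$, and every positive integer $a$, for every $\varepsilon>0$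 there exists $N$ such that $a\prod_{i=1}^k p_i^{\alpha_i}$ (nonnegative integers $\alpha_i$) is $\varepsilon$-equidistributed in base $q$ whenever $\alpha_i\ge N$ for some $i$. *)

theory Defs
  imports Complex_Main "HOL-Computational_Algebra.Primes"
begin

text \<open>Base-\<open>b\<close> digits of \<open>n\<close>, least significant first. For \<open>b \<ge> 2\<close> and \<open>n > 0\<close> this is
  the usual expansion with nonzero leading digit (see the lemmas below). The values at
  \<open>n = 0\<close> (the single digit 0) and for \<open>b < 2\<close> are mere conventions.\<close>

fun base_digits :: "nat \<Rightarrow> nat \<Rightarrow> nat list" where
  "base_digits b n = (if b < 2 \<or> n < b then [n] else (n mod b) # base_digits b (n div b))"

declare base_digits.simps [simp del]

lemma base_digits_neq_Nil: "base_digits b n \<noteq> []"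
  by (subst base_digits.simps) simp

lemma horner_sum_base_digits: "horner_sum (\<lambda>d. d) b (base_digits b n) = n"
proof (induction b n rule: base_digits.induct)
  case (1 b n)
  then show ?case
    by (subst base_digits.simps) (auto simp: mult.commute)
qed

lemma base_digits_less:
  assumes "b \<ge> 2" "d \<in> set (base_digits b n)"
  shows "d < b"
  using assms
proof (induction b n rule: base_digits.induct)
  case (1 b n)
  from 1(3) show ?case
    using 1(1,2) by (subst (asm) base_digits.simps) (auto split: if_splits)
qed

lemma last_base_digits_pos:
  assumes "b \<ge> 2" "n > 0"
  shows "last (base_digits b n) > 0"
  using assms
proof (induction b n rule: base_digits.induct)
  case (1 b n)
  then show ?case
    by (subst base_digits.simps) (auto simp: base_digits_neq_Nil div_greater_zero_iff)
qed

definition sloane :: "nat \<Rightarrow> nat \<Rightarrow> nat \<Rightarrow> nat" where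
  "sloane t b n = (\<Prod>d\<leftarrow>base_digits b n. d + t)"

definition equidistributed :: "real \<Rightarrow> nat \<Rightarrow> nat \<Rightarrow> bool" where
  "equidistributed \<epsilon> q n \<longleftrightarrow>
     (\<forall>d\<in>{0..<q}. \<bar>real (count_list (base_digits q n) d) / real (length (base_digits q n)) - 1 / real q\<bar> < \<epsilon>)"

definition conjecture_A :: bool where
  "conjecture_A \<longleftrightarrow>
     (\<forall>q F a. q > 1 \<and> finite F \<and> (\<forall>p\<in>F. prime p) \<and> \<not> prime_factors q \<subseteq> F \<and> a > 0 \<longrightarrow>
       (\<forall>N p :: nat \<Rightarrow> nat. N 0 = a \<and> (\<forall>k. p k \<in> F \<and> N (Suc k) = N k * p k) \<longrightarrow>
         (\<forall>\<epsilon>>0. \<exists>n\<^sub>0. \<forall>n\<ge>n\<^sub>0. equidistributed \<epsilon> q (N n))))"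

text \<open>The exponents \<open>\<alpha>\<^sub>i\<close> are indexed by the primes in \<open>F\<close> themselves.\<close>

definition conjecture_B :: bool where
  "conjecture_B \<longleftrightarrow>
     (\<forall>q F a. q > 1 \<and> finite F \<and> (\<forall>p\<in>F. prime p) \<and> \<not> prime_factors q \<subseteq> F \<and> a > 0 \<longrightarrow>
       (\<forall>\<epsilon>>0. \<exists>N. \<forall>\<alpha> :: nat \<Rightarrow> nat. (\<exists>p\<in>F. \<alpha> p \<ge> N) \<longrightarrow>
         equidistributed \<epsilon> q (a * (\<Prod>p\<in>F. p ^ \<alpha> p))))"

text \<open>Some iterate of \<open>x\<close> is periodic under \<open>f\<close>; period \<open>m = 1\<close> is the fixed point case.\<close>

definition eventually_reaches_cycle :: "('a \<Rightarrow> 'a) \<Rightarrow> 'a \<Rightarrow> bool" where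
  "eventually_reaches_cycle f x \<longleftrightarrow> (\<exists>k. \<exists>m\<ge>1. (f ^^ m) ((f ^^ k) x) = (f ^^ k) x)"

end

theory Submission
  imports Defs
begin

text \<open>Every value of the map is a product of primes at most \<open>b + 1\<close>. Write such a value as
  \<open>n = b\<^sup>m u\<close> with \<open>b\<close> not dividing \<open>u\<close>; then \<open>S(n) = 2\<^sup>m S(u)\<close>. Some prime \<open>p\<close> divides \<open>u\<close> to a
  smaller power than \<open>b\<close>, so \<open>u\<close> is one of finitely many constants times a product of primes
  from a set missing \<open>p\<close>, and the conjecture makes \<open>u\<close> equidistributed once it is large. The mean of
  \<open>ln (d + 2)\<close> over the digits is \<open>ln ((b + 1)!) / b\<close>, which is below \<open>ln b\<close> since \<open>(b + 1)! < b\<^sup>b\<close>, so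
  \<open>S(u) < u\<close> for large \<open>u\<close>; for bounded \<open>u\<close> the factor \<open>2\<^sup>m\<close> against \<open>b\<^sup>m\<close> gives \<open>S(n) < n\<close>. Hence
  orbits are bounded. For \<open>b = 3\<close> the reduced prime set is \<open>{2}\<close>, where Conjecture A suffices.\<close>

section \<open>Digit expansions and trailing zeros\<close>

lemma base_digits_lt: "n < b \<Longrightarrow> base_digits b n = [n]"
  by (subst base_digits.simps) simp

lemma base_digits_ge: "b \<ge> 2 \<Longrightarrow> n \<ge> b \<Longrightarrow> base_digits b n = (n mod b) # base_digits b (n div b)"
  by (subst base_digits.simps) simp

text \<open>The leading digit is nonzero, so \<open>n\<close> is at least \<open>b\<close> to the
  power of the number of digits minus one. Multiplying through by \<open>b\<close> avoids
  subtraction in the exponent.\<close>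

lemma power_length_base_digits_le:
  assumes "b \<ge> 2" "n > 0"
  shows "b ^ length (base_digits b n) \<le> b * n"
  using assms
proof (induction b n rule: base_digits.induct)
  case (1 b n)
  show ?case
  proof (cases "n < b")
    case True
    then show ?thesis using 1 by (simp add: base_digits_lt)
  next
    case False
    then have "b ^ length (base_digits b (n div b)) \<le> b * (n div b)"
      using 1 by (simp add: div_greater_zero_iff)
    also have "\<dots> \<le> n" by simp
    finally show ?thesis using False 1(2) by (simp add: base_digits_ge)
  qed
qed

lemma less_power_length_base_digits:
  assumes "b \<ge> 2"
  shows "n < b ^ length (base_digits b n)"
  using assms
proof (induction b n rule: base_digits.induct)
  case (1 b n)
  show ?case
  proof (cases "n < b")
    case True
    then show ?thesis by (simp add: base_digits_lt)
  next
    case False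
    then have "n div b < b ^ length (base_digits b (n div b))"
      using 1 by simp
    then have "n < b * b ^ length (base_digits b (n div b))"
      using 1(2) by (simp add: div_less_iff_less_mult mult.commute)
    then show ?thesis using False 1(2) by (simp add: base_digits_ge)
  qed
qed

text \<open>Multiplying a positive number by \<open>b\<close> appends one digit 0, which contributes
  the factor \<open>t\<close>. For \<open>u = 0\<close> no digit would be added.\<close>

lemma sloane_base_power_mult:
  assumes "b \<ge> 2" "u > 0"
  shows "sloane t b (b ^ m * u) = t ^ m * sloane t b u"
proof (induction m)
  case (Suc m)
  have "b * (b ^ m * u) \<ge> b" using assms by simp
  then have "base_digits b (b * (b ^ m * u)) = 0 # base_digits b (b ^ m * u)"
    using assms by (subst base_digits_ge) auto
  then have "sloane t b (b * (b ^ m * u)) = t * sloane t b (b ^ m * u)"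
    by (simp add: sloane_def)
  with Suc show ?case by (simp add: mult.assoc)
qed simp

lemma sloane_pos: "t > 0 \<Longrightarrow> sloane t b n > 0"
  unfolding sloane_def by (auto simp: prod_list_zero_iff intro!: Nat.gr0I)

section \<open>Decrease of the map at large equidistributed numbers\<close>

lemma fact_Suc_less_power:
  assumes "b \<ge> 3"
  shows "fact (Suc b) < b ^ b"
  using assms
proof (induction b rule: dec_induct)
  case base
  show ?case by (simp add: eval_nat_numeral)
next
  case (step b)
  \<comment> \<open>The two top terms of the binomial expansion are both equal to
    \<open>b ^ b\<close>, and the factor 2 gained pays for
    \<open>Suc (Suc b) \<le> 2 * Suc b\<close>. The induction starts at 3 because 3! exceeds 2 ^
    2.\<close>
  have "b ^ b + b * b ^ (b - 1) \<le> Suc b ^ b"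
  proof -
    have "Suc b ^ b = (\<Sum>k\<le>b. (b choose k) * b ^ k)"
      using binomial[of b 1 b] by simp
    also have "\<dots> \<ge> (\<Sum>k\<in>{b - 1, b}. (b choose k) * b ^ k)"
      by (intro sum_mono2) auto
    also have "(\<Sum>k\<in>{b - 1, b}. (b choose k) * b ^ k) = b ^ b + b * b ^ (b - 1)"
      using step.hyps binomial_symmetric[of 1 b] by simp
    finally show ?thesis .
  qed
  then have "2 * b ^ b \<le> Suc b ^ b"
    using step.hyps by (cases b) simp_all
  have "fact (Suc (Suc b)) = Suc (Suc b) * fact (Suc b)" by (simp only: fact_Suc of_nat_id)
  also have "\<dots> < Suc (Suc b) * b ^ b" using step.IH by (intro mult_strict_left_mono) auto
  also have "\<dots> \<le> Suc b * (2 * b ^ b)" by simp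
  also have "\<dots> \<le> Suc b * Suc b ^ b" using \<open>2 * b ^ b \<le> Suc b ^ b\<close> by (rule mult_left_mono) simp
  finally show ?case by simp
qed

lemma sum_list_eq_sum_count_real:
  fixes f :: "'a \<Rightarrow> real"
  assumes "set xs \<subseteq> X" "finite X"
  shows "(\<Sum>x\<leftarrow>xs. f x) = (\<Sum>x\<in>X. real (count_list xs x) * f x)"
  using assms(1)
proof (induction xs)
  case (Cons y xs)
  have "(\<Sum>x\<in>X. real (count_list (y # xs) x) * f x) =
      (\<Sum>x\<in>X. (if y = x then f x else 0) + real (count_list xs x) * f x)"
    by (intro sum.cong) (auto simp: algebra_simps)
  also have "\<dots> = f y + (\<Sum>x\<in>X. real (count_list xs x) * f x)"
    using Cons.prems assms(2) by (simp add: sum.distrib)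
  finally show ?case using Cons by simp
qed simp

text \<open>Grouping equal digits brings in the counts that \<open>equidistributed\<close>
  controls.\<close>

lemma ln_sloane_eq_sum_count:
  assumes "b \<ge> 2"
  shows "ln (real (sloane 2 b u)) = (\<Sum>d<b. real (count_list (base_digits b u) d) * ln (real (d + 2)))"
proof -
  have "ln (real (\<Prod>d\<leftarrow>xs. d + 2)) = (\<Sum>d\<leftarrow>xs. ln (real (d + 2)))" for xs :: "nat list"
  proof (induction xs)
    case (Cons x xs)
    have "(\<Prod>d\<leftarrow>xs. d + 2) > 0" by (auto simp: prod_list_zero_iff intro!: Nat.gr0I)
    with Cons show ?case by (simp only: list.map prod_list.Cons sum_list.Cons of_nat_mult) (subst ln_mult_pos, auto)
  qed simp
  then have "ln (real (sloane 2 b u)) = (\<Sum>d\<leftarrow>base_digits b u. ln (real (d + 2)))"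
    by (simp add: sloane_def)
  also have "\<dots> = (\<Sum>d<b. real (count_list (base_digits b u) d) * ln (real (d + 2)))"
    using base_digits_less[OF assms] by (intro sum_list_eq_sum_count_real) auto
  finally show ?thesis .
qed

lemma sum_ln_eq_ln_fact: "(\<Sum>d<b. ln (real (d + 2))) = ln (fact (Suc b))"
proof (induction b)
  case (Suc b)
  have "ln (fact (Suc (Suc b)) :: real) = ln (real (Suc (Suc b))) + ln (fact (Suc b))"
    by (subst fact_Suc, subst ln_mult_pos) (auto simp del: fact_Suc)
  with Suc show ?case by (simp del: fact_Suc)
qed simp

text \<open>For \<open>L\<close> digits, \<open>ln u\<close> is at least
  \<open>(L - 1) * ln b\<close>, whereas equidistribution bounds the logarithm of the value by
  \<open>L\<close> times a constant below \<open>ln b\<close>. The linear gap in \<open>L\<close>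
  eventually exceeds the single \<open>ln b\<close> that is lost.\<close>

lemma sloane_less_if_equidistributed:
  assumes "b \<ge> 3"
  obtains \<epsilon> U where "\<epsilon> > 0" "\<And>u. equidistributed \<epsilon> b u \<Longrightarrow> u > U \<Longrightarrow> sloane 2 b u < u"
proof -
  define f where "f = ln (fact (Suc b) :: real)"
  have "f > 0"
  proof -
    have "(fact (Suc b) :: real) \<ge> fact 2" using assms by (intro fact_mono) auto
    then show ?thesis unfolding f_def by (intro ln_gt_zero) simp
  qed
  have "(fact (Suc b) :: real) < real b ^ b"
    using fact_Suc_less_power[OF assms] by (metis of_nat_fact of_nat_less_iff of_nat_power)
  then have "f < b * ln b"
    unfolding f_def using assms by (subst ln_realpow[symmetric]) (auto simp del: fact_Suc)
  then have *: "f / b < ln b" using assms by (simp add: field_simps)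
  \<comment> \<open>Half of the gap is spent on the error \<epsilon>: with
    \<open>\<epsilon> = \<delta> / f\<close> one gets
    \<open>(1 / b + \<epsilon>) * f = ln b - \<delta>\<close>. The other half, \<delta> per digit,
    is the gain; \<open>K\<close> digits of it outweigh \<open>ln b\<close>.\<close>
  define \<delta> where "\<delta> = (ln b - f / b) / 2"
  have "\<delta> > 0" using * by (simp add: \<delta>_def)
  define \<epsilon> where "\<epsilon> = \<delta> / f"
  obtain K :: nat where K: "real K * \<delta> > ln b" using reals_Archimedean3[OF \<open>\<delta> > 0\<close>] by blast
  show ?thesis
  proof
    show "\<epsilon> > 0" using \<open>\<delta> > 0\<close> \<open>f > 0\<close> by (simp add: \<epsilon>_def)
    fix u assume eq: "equidistributed \<epsilon> b u" and u: "u > b ^ K"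
    define L where "L = length (base_digits b u)"
    have "L > 0" by (simp add: L_def base_digits_neq_Nil)
    have "b ^ K < b ^ L" using u less_power_length_base_digits[of b u] assms unfolding L_def by linarith
    then have "K < L" using assms by (simp add: power_strict_increasing_iff)
    have "u > 0" using u by simp
    have "b ^ L \<le> b * u"
      using power_length_base_digits_le[of b u] assms \<open>u > 0\<close> by (simp add: L_def)
    then have "real (b ^ L) \<le> real (b * u)" by (simp only: of_nat_le_iff)
    then have "real b ^ L \<le> real b * real u" by simp
    then have "ln (real b ^ L) \<le> ln (real b * real u)" using assms by (intro ln_mono) auto
    then have Lu: "L * ln b \<le> ln b + ln u" using assms \<open>u > 0\<close> by (simp add: ln_realpow ln_mult_pos)
    have "ln (real (sloane 2 b u)) = (\<Sum>d<b. real (count_list (base_digits b u) d) * ln (real (d + 2)))"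
      using assms by (intro ln_sloane_eq_sum_count) auto
    also have "\<dots> \<le> (\<Sum>d<b. L * (1 / b + \<epsilon>) * ln (real (d + 2)))"
    proof (intro sum_mono mult_right_mono)
      fix d assume "d \<in> {..<b}"
      with eq have "count_list (base_digits b u) d / L < 1 / b + \<epsilon>"
        unfolding equidistributed_def L_def by force
      then show "count_list (base_digits b u) d \<le> L * (1 / b + \<epsilon>)"
        using \<open>L > 0\<close> by (simp add: divide_less_eq mult.commute less_imp_le)
    qed auto
    also have "\<dots> = L * (1 / b + \<epsilon>) * f"
      by (simp only: sum_distrib_left[symmetric] sum_ln_eq_ln_fact f_def)
    also have "\<dots> = L * (ln b - \<delta>)"
      using \<open>f > 0\<close> by (simp add: \<epsilon>_def \<delta>_def field_simps)
    also have "\<dots> < L * ln b - ln b"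
    proof -
      have "real K * \<delta> \<le> real L * \<delta>" using \<open>K < L\<close> \<open>\<delta> > 0\<close> by (intro mult_right_mono) auto
      with K show ?thesis by (simp add: algebra_simps)
    qed
    also have "\<dots> \<le> ln u" using Lu by simp
    finally show "sloane 2 b u < u" using \<open>u > 0\<close> sloane_pos[of 2 b u] by simp
  qed
qed

section \<open>Instances of the two conjectures\<close>

text \<open>The instance of Conjecture B for base \<open>b\<close> in which \<open>F\<close> consists of all primes up to \<open>b + 1\<close> except
  one that divides \<open>b\<close>.\<close>

definition equidistributed_except :: "nat \<Rightarrow> bool" where
  "equidistributed_except b \<longleftrightarrow>
     (\<forall>p a \<epsilon>. prime p \<and> p dvd b \<and> a > 0 \<and> \<epsilon> > 0 \<longrightarrow>
       (\<exists>N. \<forall>\<alpha>. (\<exists>q\<in>{q. prime q \<and> q \<le> Suc b} - {p}. \<alpha> q \<ge> N) \<longrightarrow>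
         equidistributed \<epsilon> b (a * (\<Prod>q\<in>{q. prime q \<and> q \<le> Suc b} - {p}. q ^ \<alpha> q))))"

lemma equidistributed_except_if_conjecture_B:
  assumes conjecture_B "b \<ge> 2"
  shows "equidistributed_except b"
  unfolding equidistributed_except_def
proof (intro allI impI, elim conjE)
  fix p a :: nat and \<epsilon> :: real
  assume *: "prime p" "p dvd b" "a > 0" "\<epsilon> > 0"
  let ?F = "{q. prime q \<and> q \<le> Suc b} - {p}"
  have "b > 1 \<and> finite ?F \<and> (\<forall>p\<in>?F. prime p) \<and> \<not> prime_factors b \<subseteq> ?F \<and> a > 0"
    using * assms by (auto simp: in_prime_factors_iff)
  with assms(1) *(4) show "\<exists>N. \<forall>\<alpha>. (\<exists>q\<in>?F. \<alpha> q \<ge> N) \<longrightarrow> equidistributed \<epsilon> b (a * (\<Prod>q\<in>?F. q ^ \<alpha> q))"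
    unfolding conjecture_B_def by blast
qed

text \<open>Removing 3, the only prime divisor of the base, leaves just the prime 2. The products
  then form the single sequence \<open>a * 2 ^ k\<close>, which Conjecture A covers with the
  constant choice 2.\<close>

lemma equidistributed_except_3_if_conjecture_A:
  assumes conjecture_A
  shows "equidistributed_except 3"
  unfolding equidistributed_except_def
proof (intro allI impI, elim conjE)
  fix p a :: nat and \<epsilon> :: real
  assume *: "prime p" "p dvd 3" "a > 0" "\<epsilon> > 0"
  have "p = 3" 
  proof -
    have "p \<le> 3" "p \<ge> 2" using * by (auto intro: dvd_imp_le prime_ge_2_nat)
    moreover have "p \<noteq> 2" using *(2) by auto
    ultimately show ?thesis by simp
  qed
  have F: "{q. prime q \<and> q \<le> Suc 3} - {p} = {2::nat}" 
  proof -
    have "q \<le> Suc 3 \<longleftrightarrow> q = 0 \<or> q = 1 \<or> q = 2 \<or> q = 3 \<or> q = 4" for q :: nat by auto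
    moreover have "\<not> prime (4::nat)" by (simp add: prime_nat_iff) (rule exI[of _ 2], simp)
    ultimately show ?thesis using \<open>p = 3\<close> by auto
  qed
  have "prime (3::nat)" using * \<open>p = 3\<close> by simp
  then have "(3::nat) > 1 \<and> finite {2::nat} \<and> (\<forall>p\<in>{2::nat}. prime p) \<and> \<not> prime_factors 3 \<subseteq> {2::nat} \<and> a > 0"
    using * by (auto simp: prime_factorization_prime)
  with assms have "\<forall>N p :: nat \<Rightarrow> nat. N 0 = a \<and> (\<forall>k. p k \<in> {2} \<and> N (Suc k) = N k * p k) \<longrightarrow>
         (\<forall>\<epsilon>>0. \<exists>n\<^sub>0. \<forall>n\<ge>n\<^sub>0. equidistributed \<epsilon> 3 (N n))"
    unfolding conjecture_A_def by blast
  from this[rule_format, of "\<lambda>k. a * 2 ^ k" "\<lambda>_. 2" \<epsilon>] *(4)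
  have "\<exists>n\<^sub>0. \<forall>n\<ge>n\<^sub>0. equidistributed \<epsilon> 3 (a * 2 ^ n)" by simp
  then show "\<exists>N. \<forall>\<alpha>. (\<exists>q\<in>{q. prime q \<and> q \<le> Suc 3} - {p}. \<alpha> q \<ge> N) \<longrightarrow>
      equidistributed \<epsilon> 3 (a * (\<Prod>q\<in>{q. prime q \<and> q \<le> Suc 3} - {p}. q ^ \<alpha> q))"
    unfolding F by auto
qed

section \<open>Smooth numbers not divisible by the base\<close>

definition smooth :: "nat \<Rightarrow> nat \<Rightarrow> bool" where
  "smooth y n \<longleftrightarrow> n > 0 \<and> (\<forall>p. prime p \<longrightarrow> p dvd n \<longrightarrow> p \<le> y)"

lemma prime_dvd_prod_list:
  assumes "prime p" "p dvd prod_list xs"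
  shows "\<exists>x\<in>set xs. p dvd x"
  using assms(2)
proof (induction xs)
  case Nil
  then show ?case using assms(1) not_prime_unit[of p] by simp
qed (use assms(1) in \<open>auto simp: prime_dvd_mult_iff\<close>)

text \<open>A prime dividing the product divides some \<open>d + 2\<close> with
  \<open>d < b\<close>, which is at most \<open>b + 1\<close>.\<close>

lemma smooth_sloane:
  assumes "b \<ge> 2"
  shows "smooth (Suc b) (sloane 2 b n)"
proof -
  have "p \<le> Suc b" if p: "prime p" "p dvd sloane 2 b n" for p
  proof -
    obtain d where d: "d \<in> set (base_digits b n)" "p dvd d + 2"
      using p prime_dvd_prod_list[of p "map (\<lambda>d. d + 2) (base_digits b n)"] by (auto simp: sloane_def)
    then have "d < b" using base_digits_less assms by blast
    moreover have "p \<le> d + 2" using d by (intro dvd_imp_le) auto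
    ultimately show ?thesis by simp
  qed
  then show ?thesis by (auto simp: smooth_def sloane_pos)
qed

text \<open>The index set does not depend on \<open>n\<close>, as the conjecture requires; primes
  not dividing \<open>n\<close> enter with exponent 0.\<close>

lemma smooth_eq_prod_prime_powers:
  assumes "smooth y n"
  shows "n = (\<Prod>q\<in>{q. prime q \<and> q \<le> y}. q ^ multiplicity q n)"
proof -
  have "n = (\<Prod>q\<in>prime_factors n. q ^ multiplicity q n)"
    using assms prime_factorization_nat[of n] by (simp add: smooth_def)
  also have "\<dots> = (\<Prod>q\<in>{q. prime q \<and> q \<le> y}. q ^ multiplicity q n)"
    using assms by (intro prod.mono_neutral_left)
      (auto simp: smooth_def in_prime_factors_iff not_dvd_imp_multiplicity_0)
  finally show ?thesis .
qed

text \<open>If \<open>b\<close> does not divide \<open>u\<close>, some prime \<open>p\<close> has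
  exponent \<open>j\<close> in \<open>u\<close> below its exponent in \<open>b\<close>. Only
  finitely many pairs \<open>(p, j)\<close> arise, and each gives one constant
  \<open>a = p ^ j\<close> and one threshold.\<close>

lemma smooth_not_dvd_equidistributed:
  assumes "b \<ge> 2" "equidistributed_except b" "\<epsilon> > 0"
  obtains U where "\<And>u. smooth (Suc b) u \<Longrightarrow> \<not> b dvd u \<Longrightarrow> u > U \<Longrightarrow> equidistributed \<epsilon> b u"
proof -
  let ?F = "{q. prime q \<and> q \<le> Suc b}"
  have "\<exists>V. \<forall>u. smooth (Suc b) u \<and> multiplicity p u = j \<and> u > V \<longrightarrow> equidistributed \<epsilon> b u"
    if p: "prime p" "p dvd b" for p j
  proof -
    have "p \<in> ?F" using p assms(1) dvd_imp_le[of p b] by auto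
    have "p ^ j > 0" using p by (simp add: prime_gt_0_nat)
    then obtain N where N: "\<And>\<alpha>. \<exists>q\<in>?F - {p}. \<alpha> q \<ge> N \<Longrightarrow>
        equidistributed \<epsilon> b (p ^ j * (\<Prod>q\<in>?F - {p}. q ^ \<alpha> q))"
      using assms(2,3) p unfolding equidistributed_except_def by blast
    have "equidistributed \<epsilon> b u"
      \<comment> \<open>Beyond this bound the exponents of the primes other than \<open>p\<close>
        cannot all be below \<open>N\<close>.\<close>
      if u: "smooth (Suc b) u" "multiplicity p u = j" "u > p ^ j * (\<Prod>q\<in>?F - {p}. q ^ N)" for u
    proof -
      have eq: "u = p ^ j * (\<Prod>q\<in>?F - {p}. q ^ multiplicity q u)"
        using smooth_eq_prod_prime_powers[OF u(1)] u(2) \<open>p \<in> ?F\<close>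
        by (subst (asm) prod.remove[of _ p]) auto
      have "\<exists>q\<in>?F - {p}. multiplicity q u \<ge> N"
      proof (rule ccontr)
        assume "\<not> ?thesis"
        then have "(\<Prod>q\<in>?F - {p}. q ^ multiplicity q u) \<le> (\<Prod>q\<in>?F - {p}. q ^ N)"
          by (intro prod_mono) (auto intro!: power_increasing simp: Suc_le_eq prime_gt_0_nat not_le less_imp_le)
        then have "p ^ j * (\<Prod>q\<in>?F - {p}. q ^ multiplicity q u) \<le> p ^ j * (\<Prod>q\<in>?F - {p}. q ^ N)"
          by (rule mult_left_mono) simp
        with u(3) eq show False by linarith
      qed
      from N[OF this] eq show ?thesis by simp
    qed
    then show ?thesis by blast
  qed
  then obtain V where V: "\<And>p j u. prime p \<Longrightarrow> p dvd b \<Longrightarrow> smooth (Suc b) u \<Longrightarrow>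
      multiplicity p u = j \<Longrightarrow> u > V p j \<Longrightarrow> equidistributed \<epsilon> b u"
    by metis
  \<comment> \<open>A sum of natural numbers dominates each summand, so sums serve as a common
    threshold for all pairs.\<close>
  define W where "W = (\<lambda>p. \<Sum>j<multiplicity p b. V p j)"
  show ?thesis
  proof
    fix u assume u: "smooth (Suc b) u" "\<not> b dvd u" "u > (\<Sum>p\<in>?F. W p)"
    have "u \<noteq> 0" using u by (simp add: smooth_def)
    obtain p where p: "prime p" "multiplicity p u < multiplicity p b"
      using u(2) \<open>u \<noteq> 0\<close> assms(1) multiplicity_le_imp_dvd[of b u] by (metis not_le not_numeral_le_zero)
    have "p dvd b" using p by (metis not_dvd_imp_multiplicity_0 not_less0)
    then have "p \<in> ?F" using p assms(1) dvd_imp_le[of p b] by auto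
    have "V p (multiplicity p u) \<le> W p" unfolding W_def using p by (intro member_le_sum) auto
    also have "\<dots> \<le> (\<Sum>p\<in>?F. W p)" using \<open>p \<in> ?F\<close> by (intro member_le_sum) auto
    finally show "equidistributed \<epsilon> b u" using V[OF p(1) \<open>p dvd b\<close> u(1) refl] u(3) by simp
  qed
qed

section \<open>Decrease of the map at large smooth numbers\<close>

lemma sloane_less_if_smooth:
  assumes "b \<ge> 3" "equidistributed_except b"
  obtains B where "\<And>n. smooth (Suc b) n \<Longrightarrow> n > B \<Longrightarrow> sloane 2 b n < n"
proof -
  have b2: "b \<ge> 2" using assms by simp
  obtain \<epsilon> U1 where U1: "\<epsilon> > 0" "\<And>u. equidistributed \<epsilon> b u \<Longrightarrow> u > U1 \<Longrightarrow> sloane 2 b u < u"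
    using sloane_less_if_equidistributed[OF assms(1)] by blast
  obtain U2 where U2: "\<And>u. smooth (Suc b) u \<Longrightarrow> \<not> b dvd u \<Longrightarrow> u > U2 \<Longrightarrow> equidistributed \<epsilon> b u"
    using smooth_not_dvd_equidistributed[OF b2 assms(2) U1(1)] by blast
  define U where "U = max U1 U2"
  define C where "C = Max (sloane 2 b ` {..U})"
  \<comment> \<open>Since \<open>b \<ge> 3\<close>, each trailing zero makes \<open>n\<close> gain a
    factor of at least 3/2 over its image; \<open>M\<close> zeros outweigh every value at arguments
    up to \<open>U\<close>.\<close>
  obtain M where M: "real C < (3 / 2) ^ M" using real_arch_pow[of "3/2" "real C"] by auto
  show ?thesis
  proof
    \<comment> \<open>The bound \<open>b ^ M * U\<close> is chosen so that \<open>u \<le> U\<close>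
      forces more than \<open>M\<close> trailing zeros.\<close>
    fix n assume n: "smooth (Suc b) n" "n > b ^ M * U"
    have "n \<noteq> 0" "\<not> is_unit b" using n assms by (auto simp: smooth_def)
    then obtain u where u: "n = b ^ multiplicity b n * u" "\<not> b dvd u"
      using multiplicity_decompose'[of n b] by blast
    define m where "m = multiplicity b n"
    have "u > 0" using u(1) \<open>n \<noteq> 0\<close> by (intro Nat.gr0I) simp
    have "smooth (Suc b) u" using n(1) \<open>u > 0\<close> unfolding smooth_def by (metis u(1) dvd_mult)
    have S: "sloane 2 b n = 2 ^ m * sloane 2 b u"
      using u(1) sloane_base_power_mult[OF b2 \<open>u > 0\<close>] unfolding m_def by metis
    have nm: "n = b ^ m * u" using u(1) by (simp add: m_def)
    show "sloane 2 b n < n"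
    proof (cases "u > U")
      case True
      then have "sloane 2 b u < u" using U1(2) U2 \<open>smooth (Suc b) u\<close> u(2) by (simp add: U_def)
      then have "2 ^ m * sloane 2 b u < 2 ^ m * u" by simp
      also have "\<dots> \<le> b ^ m * u" using b2 by (intro mult_right_mono power_mono) auto
      finally show ?thesis using S nm by simp
    next
      case False
      then have "b ^ m * u \<le> b ^ m * U" by simp
      then have "b ^ M * U < b ^ m * U" using n(2) nm by linarith
      then have "M < m" using assms(1) by (simp add: power_strict_increasing_iff)
      have "sloane 2 b u \<le> C" unfolding C_def using False by (intro Max_ge) auto
      then have "real (sloane 2 b u) < (3 / 2) ^ M" using M by linarith
      also have "\<dots> \<le> (3 / 2) ^ m" using \<open>M < m\<close> by (intro power_increasing) auto
      finally have "2 ^ m * real (sloane 2 b u) < 2 ^ m * (3 / 2) ^ m" by simp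
      also have "\<dots> = 3 ^ m" by (simp add: power_mult_distrib[symmetric])
      also have "\<dots> \<le> real b ^ m" using assms(1) by (intro power_mono) auto
      also have "\<dots> \<le> real b ^ m * real u" using \<open>u > 0\<close> mult_left_mono[of 1 "real u" "real b ^ m"] by simp
      finally have "real (2 ^ m * sloane 2 b u) < real (b ^ m * u)" by simp
      then show ?thesis using S nm by (simp only: of_nat_less_iff)
    qed
  qed
qed

section \<open>From eventual decrease to cycles\<close>

lemma eventually_reaches_cycle_if_finite_orbit:
  assumes "finite (range (\<lambda>k. (f ^^ k) x))"
  shows "eventually_reaches_cycle f x"
proof -
  have "\<not> inj (\<lambda>k. (f ^^ k) x)" using assms finite_imageD by blast
  then obtain i j where "i \<noteq> j" "(f ^^ i) x = (f ^^ j) x" by (auto simp: inj_def)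
  then obtain i j where "i < j" and eq: "(f ^^ i) x = (f ^^ j) x" by (metis linorder_neqE_nat)
  then have "(f ^^ (j - i)) ((f ^^ i) x) = (f ^^ i) x"
    by (metis comp_apply funpow_add le_add_diff_inverse2 less_imp_le)
  then show ?thesis unfolding eventually_reaches_cycle_def using \<open>i < j\<close>
    by (intro exI[of _ i] exI[of _ "j - i"]) auto
qed

lemma eventually_reaches_cycle_if_eventually_decreasing:
  fixes f :: "nat \<Rightarrow> nat"
  assumes P: "\<And>n. P (f n)" and B: "\<And>n. P n \<Longrightarrow> n > B \<Longrightarrow> f n < n"
  shows "eventually_reaches_cycle f x"
proof -
  \<comment> \<open>The start \<open>x\<close> need not satisfy \<open>P\<close>, so
    \<open>f x\<close> may exceed \<open>x\<close> even for large \<open>x\<close> and is included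
    separately. From the first iterate on, a step either starts at most at \<open>B\<close> or
    decreases.\<close>
  define M where "M = Max (insert x (insert (f x) (f ` {..B})))"
  have M: "x \<le> M" "f x \<le> M" "\<And>n. n \<le> B \<Longrightarrow> f n \<le> M" unfolding M_def by (intro Max_ge; auto)+
  have "(f ^^ k) x \<le> M" for k
  proof (induction k)
    case (Suc k)
    show ?case
    proof (cases k)
      case (Suc l)
      then have "P ((f ^^ k) x)" using P by simp
      then show ?thesis using B[of "(f ^^ k) x"] M(3)[of "(f ^^ k) x"] Suc.IH
        by (cases "(f ^^ k) x \<le> B") auto
    qed (simp add: M)
  qed (simp add: M)
  then have "range (\<lambda>k. (f ^^ k) x) \<subseteq> {..M}" by auto
  then show ?thesis
    by (rule eventually_reaches_cycle_if_finite_orbit[OF finite_subset]) simp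
qed

lemma sloane_eventually_reaches_cycle:
  assumes "b \<ge> 3" "equidistributed_except b"
  shows "eventually_reaches_cycle (sloane 2 b) n"
proof -
  obtain B where "\<And>n. smooth (Suc b) n \<Longrightarrow> n > B \<Longrightarrow> sloane 2 b n < n"
    using sloane_less_if_smooth[OF assms] by blast
  moreover have "smooth (Suc b) (sloane 2 b n)" for n
    using assms(1) by (intro smooth_sloane) simp
  ultimately show ?thesis
    using eventually_reaches_cycle_if_eventually_decreasing[of "smooth (Suc b)" "sloane 2 b" B n] by blast
qed

theorem theorem15:
  shows "(conjecture_A \<longrightarrow> (\<forall>n\<ge>1. eventually_reaches_cycle (sloane 2 3) n)) \<and>
         (conjecture_B \<longrightarrow> (\<forall>b\<ge>4. \<forall>n\<ge>1. eventually_reaches_cycle (sloane 2 b) n))"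
  using sloane_eventually_reaches_cycle equidistributed_except_3_if_conjecture_A
    equidistributed_except_if_conjecture_B
  by auto

end
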